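(* In the matching market with preference uncertainty described in the context, for every signal profile $\pi$ the set $MC(\pi)\subseteq[0,t]^n$ of ex-ante cutoffs that clear the market under $\pi$ is nonempty. Moreover, $MC(\pi)$, ordered by the componentwise order of $\mathbb{R}^n$, is a complete lattice.
   Context: Market. $S=\{s_1,\dots,s_t\}$ is a finite set of students and $P=\{p_1,\dots,p_n\}$ a finite set of programs. Each program $p$ has a strict priority (strict linear order) $\mathcal{R}_p$ over $S$ ($s\,\mathcal{R}_p\,s'$ means $s$ has higher priority than $s'$) and a capacity $M_p$, a positive integer. $\Omega$ is a finite set of states; in each state each student has a strict preference over $P$. $\psi\in\Delta(\Omega)$ is a common prior. Student $s_k$ has utility $u_k:P\times\Omega\to\mathbb{R}$ with $u_k(p,\omega)>u_k(p',\omega)$ iff $s_k$ strictly prefers $p$ to $p'$ in state $\omega$. Signals. A signal $\pi_k$ of $s_k$ consists of a finite set $I_k$ of realizations and distributions $\pi_k(\cdot|\omega)\in\Delta(I_k)$, $\omega\in\Omega$. Realization $i_k$ induces the Bayesian posterior $\mu_k^{i_k}(\omega)=\pi_k(i_k|\omega)\psi(\omega)/\sum_{\omega'}\pi_k(i_k|\omega')\psi(\omega')$. A signal profile is $\pi=(\pi_k)_{1\le k\le t}$. Standing assumption: no two distinct programs give a student the same expected payoff under the prior or under any posterior. Cutoffs. The rank of $s_k$ at $p$ is $r_p(s_k)=1+|\{s\in S: s\,\mathcal{R}_p\,s_k\}|$. A deterministic cutoff is $\bar b\in\bar B=\mathbb{N}^n$ (with $0\in\mathbb{N}$), and $C(s_k,\bar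 b)=\{p\in P: r_p(s_k)\le\bar b_p\}$ is the induced choice set. For $b\in\mathbb{R}^n_{\ge0}$ let $\phi^b_p(m)=\max\{0,1-|b_p-m|\}$ for $m\in\mathbb{N}$ (so $b_p$ is randomized between the two adjacent integers with mean $b_p$) and $\phi^b(\bar b)=\prod_{p\in P}\phi^b_p(\bar b_p)$, a probability distribution on $\bar B$. Ex-ante cutoffs (for market clearing) are elements of $[0,t]^n$. Decision rule. For nonempty $C\subseteq P$, $\sigma_k(C,i_k)=\arg\max_{p\in C}\sum_{\omega}\mu_k^{i_k}(\omega)u_k(p,\omega)$. A student with empty choice set is unmatched (chooses no program). Demand and market clearing. $D^\pi_p(b)=\sum_{\bar b,k,i_k,\omega}\phi^b(\bar b)\,\psi(\omega)\,\pi_k(i_k|\omega)\,\mathbf{1}\{\sigma_k(C(s_k,\bar b),i_k)=p\}$, where the indicator is $0$ if $C(s_k,\bar b)=\emptyset$. An ex-ante cutoff $b\in[0,t]^n$ clears the market under $\pi$ if for all $p\in P$, $D^\pi_p(b)\le M_p$, with equality whenever $b_p<t$. $MC(\pi)$ is the set of all such $b$. *)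

theory Defs
  imports "HOL-Probability.Probability" "HOL-Algebra.Complete_Lattice"
begin

text \<open>
  The finite types \<open>'s\<close>, \<open>'p\<close>, \<open>'w\<close> are the sets of students, programs and states, so that
  \<open>t = CARD('s)\<close>, \<open>n = CARD('p)\<close>, ex-ante cutoffs live in \<open>real ^ 'p\<close>, deterministic
  cutoffs in \<open>nat ^ 'p\<close>, and distributions over states are elements of \<open>'w pmf\<close>.
  In \<open>priority\<close> and \<open>preference\<close> the first component of a pair is the better one.
\<close>

record ('s, 'p, 'w) market =
  priority :: "'p \<Rightarrow> ('s \<times> 's) set"
  capacity :: "'p \<Rightarrow> nat"
  preference :: "'s \<Rightarrow> 'w \<Rightarrow> ('p \<times> 'p) set"
  prior :: "'w pmf"
  utility :: "'s \<Rightarrow> 'p \<Rightarrow> 'w \<Rightarrow> real"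

text \<open>
  The realization sets of all students are taken inside one type \<open>'i\<close>;
  they may differ, and being finite they can always be embedded in a common type.
\<close>

record ('s, 'w, 'i) signal_profile =
  realizations :: "'s \<Rightarrow> 'i set"
  signal :: "'s \<Rightarrow> 'w \<Rightarrow> 'i pmf"

definition expected_payoff ::
  "('s, 'p, 'w::finite) market \<Rightarrow> 's \<Rightarrow> ('w \<Rightarrow> real) \<Rightarrow> 'p \<Rightarrow> real" where
  "expected_payoff E k \<mu> p = (\<Sum>\<omega>\<in>UNIV. \<mu> \<omega> * utility E k p \<omega>)"

definition valid_market :: "('s::finite, 'p::finite, 'w::finite) market \<Rightarrow> bool" where
  "valid_market E \<longleftrightarrow>
     (\<forall>p. strict_linear_order_on UNIV (priority E p)) \<and>
     (\<forall>p. 0 < capacity E p) \<and>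
     (\<forall>k \<omega>. strict_linear_order_on UNIV (preference E k \<omega>)) \<and>
     (\<forall>k \<omega> p p'. utility E k p \<omega> > utility E k p' \<omega> \<longleftrightarrow> (p, p') \<in> preference E k \<omega>) \<and>
     (\<forall>k. inj (expected_payoff E k (pmf (prior E))))"

definition realization_prob ::
  "('s, 'p, 'w::finite) market \<Rightarrow> ('s, 'w, 'i) signal_profile \<Rightarrow> 's \<Rightarrow> 'i \<Rightarrow> real" where
  "realization_prob E \<pi> k i = (\<Sum>\<omega>\<in>UNIV. pmf (signal \<pi> k \<omega>) i * pmf (prior E) \<omega>)"

definition posterior ::
  "('s, 'p, 'w::finite) market \<Rightarrow> ('s, 'w, 'i) signal_profile \<Rightarrow> 's \<Rightarrow> 'i \<Rightarrow> 'w \<Rightarrow> real" where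
  "posterior E \<pi> k i \<omega> = pmf (signal \<pi> k \<omega>) i * pmf (prior E) \<omega> / realization_prob E \<pi> k i"

text \<open>
  Bayes' rule defines a posterior only for realizations of positive probability, so payoff ties
  are excluded only there. Realizations of probability zero have weight zero in \<open>demand\<close>.
\<close>

definition valid_signal_profile ::
  "('s::finite, 'p::finite, 'w::finite) market \<Rightarrow> ('s, 'w, 'i) signal_profile \<Rightarrow> bool" where
  "valid_signal_profile E \<pi> \<longleftrightarrow>
     (\<forall>k. finite (realizations \<pi> k)) \<and>
     (\<forall>k \<omega>. set_pmf (signal \<pi> k \<omega>) \<subseteq> realizations \<pi> k) \<and>
     (\<forall>k. \<forall>i \<in> realizations \<pi> k. realization_prob E \<pi> k i > 0 \<longrightarrow>
        inj (expected_payoff E k (posterior E \<pi> k i)))"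

definition rank :: "('s, 'p, 'w) market \<Rightarrow> 'p \<Rightarrow> 's \<Rightarrow> nat" where
  "rank E p k = 1 + card {s. (s, k) \<in> priority E p}"

definition choice_set :: "('s, 'p::finite, 'w) market \<Rightarrow> 's \<Rightarrow> nat ^ 'p \<Rightarrow> 'p set" where
  "choice_set E k c = {p. rank E p k \<le> c $ p}"

definition cutoff_weight :: "real ^ 'p::finite \<Rightarrow> nat ^ 'p \<Rightarrow> real" where
  "cutoff_weight b c = (\<Prod>p\<in>UNIV. max 0 (1 - \<bar>b $ p - real (c $ p)\<bar>))"

text \<open>Only meaningful for nonempty \<open>C\<close>.\<close>

definition decision ::
  "('s, 'p, 'w::finite) market \<Rightarrow> ('s, 'w, 'i) signal_profile \<Rightarrow> 's \<Rightarrow> 'p set \<Rightarrow> 'i \<Rightarrow> 'p" where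
  "decision E \<pi> k C i = arg_max_on (expected_payoff E k (posterior E \<pi> k i)) C"

text \<open>The infinite sum over \<open>nat ^ 'p\<close> has only finitely many nonzero terms.\<close>

definition demand ::
  "('s::finite, 'p::finite, 'w::finite) market \<Rightarrow> ('s, 'w, 'i) signal_profile \<Rightarrow>
   real ^ 'p \<Rightarrow> 'p \<Rightarrow> real" where
  "demand E \<pi> b p =
     (\<Sum>\<^sub>\<infinity>c\<in>UNIV. \<Sum>k\<in>UNIV. \<Sum>i\<in>realizations \<pi> k. \<Sum>\<omega>\<in>UNIV.
        cutoff_weight b c * pmf (prior E) \<omega> * pmf (signal \<pi> k \<omega>) i *
        of_bool (choice_set E k c \<noteq> {} \<and> decision E \<pi> k (choice_set E k c) i = p))"

definition clears_market ::
  "('s::finite, 'p::finite, 'w::finite) market \<Rightarrow> ('s, 'w, 'i) signal_profile \<Rightarrow>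
   real ^ 'p \<Rightarrow> bool" where
  "clears_market E \<pi> b \<longleftrightarrow>
     (\<forall>p. demand E \<pi> b p \<le> real (capacity E p) \<and>
          (b $ p < real CARD('s) \<longrightarrow> demand E \<pi> b p = real (capacity E p)))"

definition MC ::
  "('s::finite, 'p::finite, 'w::finite) market \<Rightarrow> ('s, 'w, 'i) signal_profile \<Rightarrow>
   (real ^ 'p) set" where
  "MC E \<pi> = {b. (\<forall>p. 0 \<le> b $ p \<and> b $ p \<le> real CARD('s)) \<and> clears_market E \<pi> b}"

end

theory Submission
  imports Defs
begin

text \<open>
  The map \<open>b\<^sub>p \<mapsto> b\<^sub>p - (D\<^sub>p b - M\<^sub>p) / t\<close>, truncated to \<open>[0, t]\<close> in every coordinate, has exactly
  the market clearing cutoffs as fixed points; the lower boundary \<open>b\<^sub>p = 0\<close> contributes no spurious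
  ones, because there \<open>D\<^sub>p b = 0 < M\<^sub>p\<close>. The map is isotone, so Knaster--Tarski applies. For
  isotonicity, write \<open>b\<^sub>p - D\<^sub>p b / t\<close> as the mean of \<open>c\<^sub>p - G\<^sub>p c / t\<close> over the randomized
  deterministic cutoffs \<open>c\<close>, where \<open>G\<^sub>p c\<close> is the demand for \<open>p\<close> given \<open>c\<close>. Raising \<open>b\<close> raises the distribution of \<open>c\<close> in the sense of
  first-order stochastic dominance, and the integrand is monotone in \<open>c\<close>: as long as \<open>c\<^sub>p\<close> is
  unchanged, larger choice sets can only divert students from \<open>p\<close>, while an increase of \<open>c\<^sub>p\<close> by
  at least \<open>1\<close> outweighs a change of at most \<open>t\<close> in \<open>G\<^sub>p\<close>.
\<close>

section \<open>Stochastic dominance of randomized cutoffs\<close>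

definition hat :: "real \<Rightarrow> nat \<Rightarrow> real" where
  "hat x m = max 0 (1 - \<bar>x - real m\<bar>)"

text \<open>For \<open>x >= 0\<close>, \<open>ramp (x - real m)\<close> is the tail probability that
  the integer drawn with weights \<open>hat x\<close> exceeds \<open>m\<close>.\<close>

definition ramp :: "real \<Rightarrow> real" where
  "ramp z = max 0 (min 1 z)"

lemma hat_nonneg: "0 \<le> hat x m"
  by (simp add: hat_def)

lemma hat_eq_ramp_diff: "hat x m = ramp (x - real m + 1) - ramp (x - real m)"
  by (auto simp: hat_def ramp_def)

lemma ramp_mono: "x \<le> y \<Longrightarrow> ramp x \<le> ramp y"
  by (auto simp: ramp_def)

text \<open>Summation by parts turns the weights \<open>hat\<close> into \<open>ramp\<close>, which is monotone in \<open>x\<close>.\<close>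

lemma sum_hat_by_parts:
  "(\<Sum>m\<le>N. hat x m * f m) =
     ramp (x + 1) * f 0 - ramp (x - real N) * f N
     + (\<Sum>m<N. ramp (x - real m) * (f (Suc m) - f m))"
  by (induction N) (auto simp: hat_eq_ramp_diff algebra_simps)

text \<open>On [0, N] the boundary terms collapse to \<open>f 0\<close>. What remains is the
  tail-sum formula for an expectation: increments of \<open>f\<close> weighted by tail
  probabilities.\<close>

lemma sum_hat_mult:
  assumes "0 \<le> x" "x \<le> real N"
  shows "(\<Sum>m\<le>N. hat x m * f m) = f 0 + (\<Sum>m<N. ramp (x - real m) * (f (Suc m) - f m))"
proof -
  have "ramp (x + 1) = 1" "ramp (x - real N) = 0"
    using assms by (auto simp: ramp_def)
  then show ?thesis
    by (simp add: sum_hat_by_parts)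
qed

lemma sum_ramp: "0 \<le> x \<Longrightarrow> (\<Sum>m<N. ramp (x - real m)) = min x (real N)"
  by (induction N) (auto simp: ramp_def)

lemma sum_hat_eq_1: "0 \<le> x \<Longrightarrow> x \<le> real N \<Longrightarrow> (\<Sum>m\<le>N. hat x m) = 1"
  using sum_hat_mult[of x N "\<lambda>_. 1"] by simp

lemma sum_hat_id: "0 \<le> x \<Longrightarrow> x \<le> real N \<Longrightarrow> (\<Sum>m\<le>N. hat x m * real m) = x"
  using sum_hat_mult[of x N real] by (simp add: sum_ramp)

lemma sum_hat_mono:
  assumes "0 \<le> x" "x \<le> y" "y \<le> real N"
    and "\<And>m. m < N \<Longrightarrow> f m \<le> f (Suc m)"
  shows "(\<Sum>m\<le>N. hat x m * f m) \<le> (\<Sum>m\<le>N. hat y m * f m)"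
proof -
  have "(\<Sum>m<N. ramp (x - real m) * (f (Suc m) - f m))
      \<le> (\<Sum>m<N. ramp (y - real m) * (f (Suc m) - f m))"
    by (intro sum_mono mult_right_mono) (use assms ramp_mono in auto)
  then show ?thesis
    using assms by (simp add: sum_hat_mult)
qed

text \<open>Fubini for product weights: splitting off one coordinate prepares the induction over
  coordinates.\<close>

lemma sum_PiE_insert:
  fixes w :: "'a \<Rightarrow> 'b \<Rightarrow> real"
  assumes "finite A" "a \<notin> A"
  shows "(\<Sum>c\<in>insert a A \<rightarrow>\<^sub>E B. (\<Prod>q\<in>insert a A. w q (c q)) * h c)
       = (\<Sum>m\<in>B. w a m * (\<Sum>c\<in>A \<rightarrow>\<^sub>E B. (\<Prod>q\<in>A. w q (c q)) * h (c(a := m))))"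
proof -
  have prod_upd: "(\<Prod>q\<in>A. w q ((c(a := m)) q)) = (\<Prod>q\<in>A. w q (c q))" for c m
    using assms by (intro prod.cong) auto
  have "(\<Sum>c\<in>insert a A \<rightarrow>\<^sub>E B. (\<Prod>q\<in>insert a A. w q (c q)) * h c)
      = (\<Sum>(m, c)\<in>B \<times> (A \<rightarrow>\<^sub>E B). w a m * (\<Prod>q\<in>A. w q (c q)) * h (c(a := m)))"
    unfolding PiE_insert_eq using assms
    by (subst sum.reindex[OF inj_combinator[OF assms(2)]])
      (auto simp: o_def case_prod_unfold prod_upd fun_upd_same simp del: fun_upd_apply intro!: sum.cong)
  then show ?thesis
    by (simp add: sum.cartesian_product[symmetric] sum_distrib_left mult.assoc)
qed

text \<open>Coordinates are raised one at a time. Freezing one of them yields another monotone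
  integrand, so the induction ranges over all \<open>h\<close>.\<close>

lemma sum_PiE_hat_mono:
  fixes h :: "('a \<Rightarrow> nat) \<Rightarrow> real"
  assumes "finite A"
    and "\<And>q. q \<in> A \<Longrightarrow> 0 \<le> x q \<and> x q \<le> y q \<and> y q \<le> real N"
    and "mono h"
  shows "(\<Sum>c\<in>A \<rightarrow>\<^sub>E {..N}. (\<Prod>q\<in>A. hat (x q) (c q)) * h c)
       \<le> (\<Sum>c\<in>A \<rightarrow>\<^sub>E {..N}. (\<Prod>q\<in>A. hat (y q) (c q)) * h c)"
  using assms
proof (induction A arbitrary: h rule: finite_induct)
  case empty
  then show ?case by simp
next
  case (insert a A)
  define g where "g z m = (\<Sum>c\<in>A \<rightarrow>\<^sub>E {..N}. (\<Prod>q\<in>A. hat (z q) (c q)) * h (c(a := m)))" for z m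
  have g_le: "g x m \<le> g y m" for m
    unfolding g_def
  proof (rule insert.IH)
    show "mono (\<lambda>c. h (c(a := m)))"
      by (intro monoI monoD[OF insert.prems(2)]) (auto simp: le_fun_def)
  qed (use insert.prems in auto)
  have g_mono: "g x m \<le> g x (Suc m)" for m
    unfolding g_def
    by (intro sum_mono mult_left_mono prod_nonneg hat_nonneg ballI monoD[OF insert.prems(2)])
      (auto simp: le_fun_def)
  \<comment> \<open>Raise coordinate \<open>a\<close> first, the others still weighted by
    \<open>x\<close>; then raise the others with \<open>a\<close> frozen.\<close>
  have "(\<Sum>m\<le>N. hat (x a) m * g x m) \<le> (\<Sum>m\<le>N. hat (y a) m * g x m)"
    using insert.prems(1)[of a] g_mono by (intro sum_hat_mono) auto
  also have "\<dots> \<le> (\<Sum>m\<le>N. hat (y a) m * g y m)"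
    by (intro sum_mono mult_left_mono g_le hat_nonneg)
  finally show ?case
    unfolding g_def sum_PiE_insert[OF insert.hyps(1,2), where w = "\<lambda>q. hat (x q)"]
      sum_PiE_insert[OF insert.hyps(1,2), where w = "\<lambda>q. hat (y q)"] .
qed

definition cutoff_mean :: "real ^ 'p::finite \<Rightarrow> (nat ^ 'p \<Rightarrow> real) \<Rightarrow> real" where
  "cutoff_mean b h = (\<Sum>\<^sub>\<infinity>c\<in>UNIV. cutoff_weight b c * h c)"

lemma cutoff_weight_eq_hat: "cutoff_weight b c = (\<Prod>p\<in>UNIV. hat (b $ p) (c $ p))"
  by (simp add: cutoff_weight_def hat_def)

lemma cutoff_mean_eq_sum_PiE:
  fixes b :: "real ^ 'p::finite"
  assumes "\<And>p. b $ p \<le> real N"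
  shows "cutoff_mean b h =
     (\<Sum>c\<in>UNIV \<rightarrow>\<^sub>E {..N}. (\<Prod>p\<in>UNIV. hat (b $ p) (c p)) * h (vec_lambda c))"
proof -
  define X :: "(nat ^ 'p) set" where "X = vec_lambda ` (UNIV \<rightarrow>\<^sub>E {..N})"
  have inj: "inj_on vec_lambda (UNIV \<rightarrow>\<^sub>E {..N})"
    by (auto intro!: inj_onI simp: vec_lambda_inject)
  have "finite X"
    by (simp add: X_def finite_PiE)
  have zero: "cutoff_weight b c = 0" if "c \<notin> X" for c
  proof -
    have "c = vec_lambda (vec_nth c)" by simp
    with that have "vec_nth c \<notin> UNIV \<rightarrow>\<^sub>E {..N}"
      unfolding X_def by (metis imageI)
    \<comment> \<open>By integrality \<open>c $ p >= N + 1 >= b $ p + 1\<close>, exactly where the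
      hat function reaches zero.\<close>
    then obtain p where "N < c $ p"
      by (auto simp: PiE_iff not_le)
    with assms[of p] have "hat (b $ p) (c $ p) = 0"
      by (auto simp: hat_def)
    then show ?thesis
      by (auto simp: cutoff_weight_eq_hat)
  qed
  have "cutoff_mean b h = (\<Sum>\<^sub>\<infinity>c\<in>X. cutoff_weight b c * h c)"
    unfolding cutoff_mean_def by (rule infsum_cong_neutral) (auto simp: zero)
  also have "\<dots> = (\<Sum>c\<in>X. cutoff_weight b c * h c)"
    using \<open>finite X\<close> by simp
  also have "\<dots> = (\<Sum>c\<in>UNIV \<rightarrow>\<^sub>E {..N}. (\<Prod>p\<in>UNIV. hat (b $ p) (c p)) * h (vec_lambda c))"
    unfolding X_def by (subst sum.reindex[OF inj]) (simp add: cutoff_weight_eq_hat)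
  finally show ?thesis .
qed

lemma vec_le_nat:
  fixes b :: "real ^ 'p::finite"
  obtains N where "\<And>p. b $ p \<le> real N"
proof
  fix p
  have "b $ p \<le> Max (range (vec_nth b))"
    by simp
  then show "b $ p \<le> real (nat \<lceil>Max (range (vec_nth b))\<rceil>)"
    by linarith
qed

lemma cutoff_mean_mono:
  assumes "\<And>p. 0 \<le> b $ p" "b \<le> b'" "mono h"
  shows "cutoff_mean b h \<le> cutoff_mean b' h"
proof -
  obtain N where N: "\<And>p. b' $ p \<le> real N"
    using vec_le_nat[of b'] by blast
  have le: "b $ p \<le> b' $ p" for p
    using assms(2) by (simp add: less_eq_vec_def)
  have "mono (\<lambda>c. h (vec_lambda c))"
    using assms(3) by (auto simp: mono_def le_fun_def less_eq_vec_def)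
  then show ?thesis
    unfolding cutoff_mean_eq_sum_PiE[of b' N, OF N]
      cutoff_mean_eq_sum_PiE[of b N, OF order.trans[OF le N]]
    by (intro sum_PiE_hat_mono) (auto simp: assms(1) le N)
qed

lemma cutoff_mean_component_minus:
  fixes b :: "real ^ 'p::finite"
  assumes "\<And>q. 0 \<le> b $ q"
  shows "cutoff_mean b (\<lambda>c. real (c $ p) - g c) = b $ p - cutoff_mean b g"
proof -
  obtain N where N: "\<And>p. b $ p \<le> real N"
    using vec_le_nat[of b] by blast
  \<comment> \<open>Writing \<open>real (c p)\<close> as a product with factors 1 off
    \<open>p\<close> lets the sum factorize: coordinate \<open>p\<close> contributes its mean, every
    other coordinate its total mass 1.\<close>
  have "(\<Sum>c\<in>UNIV \<rightarrow>\<^sub>E {..N}. (\<Prod>q\<in>UNIV. hat (b $ q) (c q)) * real (c p))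
      = (\<Sum>c\<in>UNIV \<rightarrow>\<^sub>E {..N}. \<Prod>q\<in>UNIV. hat (b $ q) (c q) * (if q = p then real (c q) else 1))"
    by (simp add: prod.distrib)
  also have "\<dots> = (\<Prod>q\<in>UNIV. \<Sum>m\<le>N. hat (b $ q) m * (if q = p then real m else 1))"
    by (subst prod_sum_PiE) auto
  also have "\<dots> = (\<Prod>q\<in>UNIV. if q = p then b $ p else 1)"
    by (intro prod.cong) (auto simp: sum_hat_id sum_hat_eq_1 assms N)
  finally show ?thesis
    by (simp add: cutoff_mean_eq_sum_PiE[OF N] right_diff_distrib sum_subtractf)
qed

section \<open>Demand\<close>

definition demand_at ::
  "('s::finite, 'p::finite, 'w::finite) market \<Rightarrow> ('s, 'w, 'i) signal_profile \<Rightarrow> 'p \<Rightarrow>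
   nat ^ 'p \<Rightarrow> real" where
  "demand_at E \<pi> p c =
     (\<Sum>k\<in>UNIV. \<Sum>i\<in>realizations \<pi> k. \<Sum>\<omega>\<in>UNIV. pmf (prior E) \<omega> * pmf (signal \<pi> k \<omega>) i *
        of_bool (choice_set E k c \<noteq> {} \<and> decision E \<pi> k (choice_set E k c) i = p))"

lemma demand_eq_cutoff_mean: "demand E \<pi> b p = cutoff_mean b (demand_at E \<pi> p)"
  by (simp add: demand_def cutoff_mean_def demand_at_def sum_distrib_left mult.assoc)

lemma demand_at_nonneg: "0 \<le> demand_at E \<pi> p c"
  by (simp add: demand_at_def sum_nonneg)

text \<open>Without the indicator, each student contributes total probability 1.\<close>

lemma demand_at_le:
  fixes E :: "('s::finite, 'p::finite, 'w::finite) market"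
  assumes "valid_signal_profile E \<pi>"
  shows "demand_at E \<pi> p c \<le> real CARD('s)"
proof -
  have "demand_at E \<pi> p c
      \<le> (\<Sum>k\<in>UNIV. \<Sum>i\<in>realizations \<pi> k. \<Sum>\<omega>\<in>UNIV. pmf (prior E) \<omega> * pmf (signal \<pi> k \<omega>) i)"
    unfolding demand_at_def by (intro sum_mono) (simp add: mult_left_le)
  also have "\<dots> = (\<Sum>k\<in>UNIV. \<Sum>\<omega>\<in>UNIV. pmf (prior E) \<omega> *
      (\<Sum>i\<in>realizations \<pi> k. pmf (signal \<pi> k \<omega>) i))"
    by (subst sum.swap) (simp add: sum_distrib_left)
  also have "\<dots> = (\<Sum>k\<in>(UNIV :: 's set). \<Sum>\<omega>\<in>UNIV. pmf (prior E) \<omega>)"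
    using assms by (simp add: valid_signal_profile_def sum_pmf_eq_1)
  also have "\<dots> = real CARD('s)"
    by (simp add: sum_pmf_eq_1)
  finally show ?thesis .
qed

text \<open>Injectivity makes the maximizer unique, so the choice operator behind
  \<open>arg_max_on\<close> is pinned down.\<close>

lemma arg_max_on_eq_iff:
  fixes f :: "'a \<Rightarrow> 'b::linorder"
  assumes "inj f" "finite C" "C \<noteq> {}"
  shows "arg_max_on f C = p \<longleftrightarrow> p \<in> C \<and> (\<forall>q\<in>C. f q \<le> f p)"
proof -
  obtain m where m: "m \<in> C" "\<forall>q\<in>C. f q \<le> f m"
    using Max_in[of "f ` C"] Max_ge[of "f ` C"] assms by fastforce
  have "f (arg_max_on f C) = f m"
    unfolding arg_max_on_def using m by (intro arg_max_equality) auto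
  then have "arg_max_on f C = m"
    using assms(1) by (simp add: inj_eq)
  then show ?thesis
    using m assms(1) by (metis injD order.antisym)
qed

text \<open>Positive weight in a single state already gives the realization positive probability,
  where validity excludes payoff ties.\<close>

lemma decision_eq_iff:
  fixes E :: "('s::finite, 'p::finite, 'w::finite) market"
  assumes "valid_signal_profile E \<pi>" "i \<in> realizations \<pi> k"
    and pos: "0 < pmf (prior E) \<omega> * pmf (signal \<pi> k \<omega>) i" and "C \<noteq> {}"
  shows "decision E \<pi> k C i = p \<longleftrightarrow>
    p \<in> C \<and> (\<forall>q\<in>C. expected_payoff E k (posterior E \<pi> k i) q
                 \<le> expected_payoff E k (posterior E \<pi> k i) p)"
proof -
  have "0 < realization_prob E \<pi> k i"
    unfolding realization_prob_def
    by (rule sum_pos2[where i = \<omega>]) (use pos in \<open>auto simp: mult.commute\<close>)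
  then have "inj (expected_payoff E k (posterior E \<pi> k i))"
    using assms by (simp add: valid_signal_profile_def)
  then show ?thesis
    unfolding decision_def using \<open>C \<noteq> {}\<close> by (intro arg_max_on_eq_iff) auto
qed

text \<open>Independence of irrelevant alternatives: a best program in the larger choice set that is
  also available in the smaller one is best there. Equal cutoffs at \<open>p\<close> keep its
  availability unchanged.\<close>

lemma demand_at_antimono:
  fixes E :: "('s::finite, 'p::finite, 'w::finite) market"
  assumes valid: "valid_signal_profile E \<pi>" and le: "c \<le> c'" and eq: "c $ p = c' $ p"
  shows "demand_at E \<pi> p c' \<le> demand_at E \<pi> p c"
  unfolding demand_at_def
proof (intro sum_mono)
  fix k i \<omega>
  assume i: "i \<in> realizations \<pi> k"
  define P where
    "P c \<longleftrightarrow> choice_set E k c \<noteq> {} \<and> decision E \<pi> k (choice_set E k c) i = p" for c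
  have "choice_set E k c \<subseteq> choice_set E k c'"
    using le by (auto simp: choice_set_def less_eq_vec_def intro: order.trans)
  moreover have "p \<in> choice_set E k c \<longleftrightarrow> p \<in> choice_set E k c'"
    using eq by (simp add: choice_set_def)
  ultimately have "P c' \<longrightarrow> P c" if "0 < pmf (prior E) \<omega> * pmf (signal \<pi> k \<omega>) i"
    using decision_eq_iff[OF valid i that, of "choice_set E k c" p]
      decision_eq_iff[OF valid i that, of "choice_set E k c'" p]
    by (auto simp: P_def)
  moreover have "0 \<le> pmf (prior E) \<omega> * pmf (signal \<pi> k \<omega>) i"
    by simp
  \<comment> \<open>Terms of weight zero, where ties are possible, vanish on both sides.\<close>
  ultimately have "pmf (prior E) \<omega> * pmf (signal \<pi> k \<omega>) i * of_bool (P c')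
      \<le> pmf (prior E) \<omega> * pmf (signal \<pi> k \<omega>) i * of_bool (P c)"
    by (cases "pmf (prior E) \<omega> * pmf (signal \<pi> k \<omega>) i = 0") (auto simp: less_le)
  then show "pmf (prior E) \<omega> * pmf (signal \<pi> k \<omega>) i *
        of_bool (choice_set E k c' \<noteq> {} \<and> decision E \<pi> k (choice_set E k c') i = p)
      \<le> pmf (prior E) \<omega> * pmf (signal \<pi> k \<omega>) i *
        of_bool (choice_set E k c \<noteq> {} \<and> decision E \<pi> k (choice_set E k c) i = p)"
    by (simp add: P_def)
qed

lemma demand_at_eq_0:
  assumes valid: "valid_signal_profile E \<pi>" and "c $ p = 0"
  shows "demand_at E \<pi> p c = 0"
proof -
  \<comment> \<open>Ranks start at 1, so a cutoff of 0 admits nobody.\<close>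
  have notin: "p \<notin> choice_set E k c" for k
    using \<open>c $ p = 0\<close> by (simp add: choice_set_def rank_def)
  have "pmf (prior E) \<omega> * pmf (signal \<pi> k \<omega>) i *
      of_bool (choice_set E k c \<noteq> {} \<and> decision E \<pi> k (choice_set E k c) i = p) = 0"
    if i: "i \<in> realizations \<pi> k" for k i \<omega>
  proof (cases "0 < pmf (prior E) \<omega> * pmf (signal \<pi> k \<omega>) i")
    case True
    then show ?thesis
      using decision_eq_iff[OF valid i True] notin by auto
  next
    case False
    moreover have "0 \<le> pmf (prior E) \<omega> * pmf (signal \<pi> k \<omega>) i"
      by simp
    ultimately have "pmf (prior E) \<omega> * pmf (signal \<pi> k \<omega>) i = 0"
      by linarith
    then show ?thesis by simp
  qed
  then show ?thesis
    unfolding demand_at_def by (intro sum.neutral ballI)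
qed

lemma demand_eq_0:
  assumes "valid_signal_profile E \<pi>" "b $ p = 0"
  shows "demand E \<pi> b p = 0"
proof -
  have "cutoff_weight b c * demand_at E \<pi> p c = 0" for c
  proof (cases "c $ p = 0")
    case True
    then show ?thesis
      by (simp add: demand_at_eq_0[OF assms(1)])
  next
    case False
    then have "hat (b $ p) (c $ p) = 0"
      using assms(2) by (simp add: hat_def)
    then show ?thesis
      by (auto simp: cutoff_weight_eq_hat)
  qed
  then show ?thesis
    unfolding demand_eq_cutoff_mean cutoff_mean_def by (intro infsum_0)
qed

lemma mono_cutoff_minus_demand_at:
  fixes E :: "('s::finite, 'p::finite, 'w::finite) market"
  assumes "valid_signal_profile E \<pi>"
  shows "mono (\<lambda>c. real (c $ p) - demand_at E \<pi> p c / real CARD('s))"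
proof (rule monoI)
  fix c c' :: "nat ^ 'p"
  assume le: "c \<le> c'"
  show "real (c $ p) - demand_at E \<pi> p c / real CARD('s)
      \<le> real (c' $ p) - demand_at E \<pi> p c' / real CARD('s)"
  proof (cases "c $ p = c' $ p")
    case True
    then show ?thesis
      using demand_at_antimono[OF assms le True] by (simp add: divide_right_mono)
  next
    case False
    then have "real (c $ p) + 1 \<le> real (c' $ p)"
      using le by (metis less_eq_vec_def less_eq_Suc_le order_le_less Suc_eq_plus1 of_nat_1 of_nat_add of_nat_le_iff)
    moreover have "demand_at E \<pi> p c' / real CARD('s) \<le> 1"
      using demand_at_le[OF assms] by (simp add: divide_le_eq)
    moreover have "0 \<le> demand_at E \<pi> p c / real CARD('s)"
      by (simp add: demand_at_nonneg)
    ultimately show ?thesis by linarith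
  qed
qed

text \<open>Both sides are means of one monotone function of the deterministic cutoff, so stochastic
  dominance compares them.\<close>

lemma cutoff_minus_demand_mono:
  fixes E :: "('s::finite, 'p::finite, 'w::finite) market"
  assumes "valid_signal_profile E \<pi>" "\<And>q. 0 \<le> b $ q" "b \<le> b'"
  shows "b $ p - demand E \<pi> b p / real CARD('s) \<le> b' $ p - demand E \<pi> b' p / real CARD('s)"
proof -
  have eq: "cutoff_mean x (\<lambda>c. real (c $ p) - demand_at E \<pi> p c / real CARD('s))
      = x $ p - demand E \<pi> x p / real CARD('s)" if "\<And>q. 0 \<le> x $ q" for x
  proof -
    have "cutoff_mean x (\<lambda>c. demand_at E \<pi> p c / real CARD('s))
        = demand E \<pi> x p / real CARD('s)"
      by (simp add: demand_eq_cutoff_mean cutoff_mean_def divide_inverse infsum_cmult_left'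
          flip: mult.assoc)
    then show ?thesis
      by (simp add: cutoff_mean_component_minus[OF that])
  qed
  have "0 \<le> b' $ q" for q
    using assms(2)[of q] assms(3) by (auto simp: less_eq_vec_def intro: order.trans)
  then show ?thesis
    using cutoff_mean_mono[OF assms(2,3) mono_cutoff_minus_demand_at[OF assms(1)], of p]
    by (simp add: eq assms(2))
qed

section \<open>Market clearing as a fixed point problem\<close>

lemma complete_lattice_atLeastAtMost:
  fixes a b :: "'a::conditionally_complete_lattice"
  assumes "a \<le> b"
  shows "complete_lattice \<lparr>carrier = {a..b}, eq = (=), le = (\<le>)\<rparr>" (is "complete_lattice ?L")
proof -
  interpret partial_order ?L
    by standard auto
  show ?thesis
  proof (rule complete_latticeI)
    fix A
    assume A: "A \<subseteq> carrier ?L"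
    then have bdd: "bdd_above A" "bdd_below A"
      by (auto intro: bdd_above_mono bdd_below_mono)
    show "\<exists>s. least ?L s (Upper ?L A)"
    proof (cases "A = {}")
      \<comment> \<open>A conditionally complete lattice says nothing useful about
        \<open>Sup {}\<close>; within the interval the least upper bound of the empty set is
        \<open>a\<close>, and dually its greatest lower bound is \<open>b\<close>.\<close>
      case True
      then show ?thesis
        using assms by (intro exI[of _ a]) (auto simp: least_def Upper_def)
    next
      case False
      then obtain x where "x \<in> A" by auto
      then have "a \<le> Sup A"
        using A bdd by (intro cSup_upper2[of x]) auto
      moreover have "Sup A \<le> b"
        using A False by (intro cSup_least) auto
      ultimately show ?thesis
        using False bdd A
        by (intro exI[of _ "Sup A"])
          (auto simp: least_def Upper_def subset_iff intro: cSup_upper intro!: cSup_least)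
    qed
    show "\<exists>s. greatest ?L s (Lower ?L A)"
    proof (cases "A = {}")
      case True
      then show ?thesis
        using assms by (intro exI[of _ b]) (auto simp: greatest_def Lower_def)
    next
      case False
      then obtain x where "x \<in> A" by auto
      then have "Inf A \<le> b"
        using A bdd by (intro cInf_lower2[of x]) auto
      moreover have "a \<le> Inf A"
        using A False by (intro cInf_greatest) auto
      ultimately show ?thesis
        using False bdd A
        by (intro exI[of _ "Inf A"])
          (auto simp: greatest_def Lower_def subset_iff intro: cInf_lower intro!: cInf_greatest)
    qed
  qed
qed

lemma complete_lattice_fixed_points:
  fixes a b :: "'a::conditionally_complete_lattice"
  assumes "a \<le> b" "f \<in> {a..b} \<rightarrow> {a..b}" "mono_on {a..b} f"
  shows "complete_lattice \<lparr>carrier = {x \<in> {a..b}. f x = x}, eq = (=), le = (\<le>)\<rparr>"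
    (is "complete_lattice ?F")
proof -
  let ?L = "\<lparr>carrier = {a..b}, eq = (=), le = (\<le>)\<rparr>"
  interpret L: complete_lattice ?L
    by (rule complete_lattice_atLeastAtMost) fact
  have "isotone ?L ?L f"
    using assms(3) L.weak_partial_order_axioms by (auto intro!: isotoneI simp: mono_on_def)
  then have "weak_complete_lattice (fpl ?L f)"
    using assms(2) by (intro Knaster_Tarski L.weak.weak_complete_lattice_axioms) auto
  moreover have "fpl ?L f = ?F"
    by (simp add: fps_def)
  ultimately interpret F: weak_complete_lattice ?F
    by simp
  \<comment> \<open>Here \<open>eq\<close> is genuine equality, which upgrades the weak complete
    lattice to a complete lattice.\<close>
  interpret partial_order ?F
    by standard auto
  show ?thesis
    by (rule complete_latticeI) (use F.sup_exists F.inf_exists in auto)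
qed

text \<open>A tatonnement step. Excess demand lowers the cutoff, because a higher cutoff admits more
  students.\<close>

definition adjust_cutoff ::
  "('s::finite, 'p::finite, 'w::finite) market \<Rightarrow> ('s, 'w, 'i) signal_profile \<Rightarrow>
   real ^ 'p \<Rightarrow> real ^ 'p" where
  "adjust_cutoff E \<pi> b = (\<chi> p. max 0 (min (real CARD('s))
     (b $ p - (demand E \<pi> b p - real (capacity E p)) / real CARD('s))))"

lemma adjust_cutoff_fixed_iff:
  fixes E :: "('s::finite, 'p::finite, 'w::finite) market"
  assumes "valid_market E" "valid_signal_profile E \<pi>"
    and b: "\<And>p. 0 \<le> b $ p" "\<And>p. b $ p \<le> real CARD('s)"
  shows "adjust_cutoff E \<pi> b = b \<longleftrightarrow> clears_market E \<pi> b"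
proof -
  have "max 0 (min (real CARD('s))
          (b $ p - (demand E \<pi> b p - real (capacity E p)) / real CARD('s))) = b $ p \<longleftrightarrow>
      demand E \<pi> b p \<le> real (capacity E p) \<and>
        (b $ p < real CARD('s) \<longrightarrow> demand E \<pi> b p = real (capacity E p))" for p
  proof -
    define z where "z = (demand E \<pi> b p - real (capacity E p)) / real CARD('s)"
    have z: "demand E \<pi> b p = real (capacity E p) \<longleftrightarrow> z = 0"
      "demand E \<pi> b p \<le> real (capacity E p) \<longleftrightarrow> z \<le> 0"
      by (auto simp: z_def divide_le_0_iff)
    \<comment> \<open>A coordinate is fixed if \<open>z = 0\<close>, or at \<open>t\<close> with
      \<open>z <= 0\<close>, or at 0 with \<open>z >= 0\<close>. Positive capacity rules out the
      last case.\<close>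
    have "z < 0" if "b $ p = 0"
      using demand_eq_0[OF assms(2) that] assms(1)
      by (simp add: z_def valid_market_def divide_less_0_iff)
    moreover have "0 < real CARD('s)"
      by simp
    ultimately show ?thesis
      unfolding z z_def[symmetric] using b[of p] by (auto simp: max_def min_def)
  qed
  then show ?thesis
    by (simp add: adjust_cutoff_def vec_eq_iff clears_market_def)
qed

text \<open>Adding the constant capacity term and truncating both preserve the order.\<close>

lemma adjust_cutoff_mono_on:
  fixes E :: "('s::finite, 'p::finite, 'w::finite) market"
  assumes "valid_signal_profile E \<pi>"
  shows "mono_on {0..d} (adjust_cutoff E \<pi>)"
proof (rule mono_onI)
  fix b b' :: "real ^ 'p"
  assume "b \<in> {0..d}" "b \<le> b'"
  then have "b $ p - demand E \<pi> b p / real CARD('s) \<le> b' $ p - demand E \<pi> b' p / real CARD('s)" for p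
    by (intro cutoff_minus_demand_mono[OF assms]) (auto simp: less_eq_vec_def)
  then have "b $ p - (demand E \<pi> b p - real (capacity E p)) / real CARD('s)
      \<le> b' $ p - (demand E \<pi> b' p - real (capacity E p)) / real CARD('s)" for p
    by (simp add: diff_divide_distrib algebra_simps)
  then show "adjust_cutoff E \<pi> b \<le> adjust_cutoff E \<pi> b'"
    unfolding adjust_cutoff_def less_eq_vec_def vec_lambda_beta
    by (intro allI max.mono min.mono order.refl)
qed

theorem proposition4p1:
  fixes E :: "('s::finite, 'p::finite, 'w::finite) market"
    and \<pi> :: "('s, 'w, 'i) signal_profile"
  assumes "valid_market E"
    and "valid_signal_profile E \<pi>"
  shows "MC E \<pi> \<noteq> {} \<and>
    complete_lattice \<lparr>carrier = MC E \<pi>, eq = (=), le = (\<le>)\<rparr>"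
proof -
  let ?t = "(\<chi> p. real CARD('s)) :: real ^ 'p"
  have "complete_lattice
      \<lparr>carrier = {b \<in> {0..?t}. adjust_cutoff E \<pi> b = b}, eq = (=), le = (\<le>)\<rparr>"
    by (intro complete_lattice_fixed_points adjust_cutoff_mono_on assms)
      (auto simp: less_eq_vec_def adjust_cutoff_def)
  moreover have "{b \<in> {0..?t}. adjust_cutoff E \<pi> b = b} = MC E \<pi>"
    using adjust_cutoff_fixed_iff[OF assms] by (auto simp: MC_def less_eq_vec_def)
  ultimately have lattice: "complete_lattice \<lparr>carrier = MC E \<pi>, eq = (=), le = (\<le>)\<rparr>"
    by simp
  then interpret complete_lattice "\<lparr>carrier = MC E \<pi>, eq = (=), le = (\<le>)\<rparr>" .
  show ?thesis
    \<comment> \<open>Nonemptiness comes from the lattice itself: its bottom element is a clearing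
      cutoff.\<close>
    using lattice bottom_closed by auto
qed

end
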